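(* Let $G\in\mathbb{F}_{q^m}^{k\times n}$ be a matrix of rank $k$ whose columns are linearly independent over $\mathbb{F}_q$, let $\mathcal{U}\subseteq\mathbb{F}_{q^m}^k$ be the $\mathbb{F}_q$-span of the columns of $G$, and let $\mathcal{I}$ be the collection of $\mathbb{F}_q$-subspaces of $\mathcal{U}$ that are $\mathbb{F}_{q^m}$-independent. Then $(\mathcal{U},\mathcal{I})$ is a $q$-matroid, i.e. there is a $q$-matroid rank function $\rho$ on the $\mathbb{F}_q$-subspaces of $\mathcal{U}$ whose independent spaces (those $V$ with $\rho(V)=\dim_{\mathbb{F}_q}V$) are exactly the members of $\mathcal{I}$. Moreover, if $(\mathbb{F}_q^n,r)$ is a $q$-matroid represented over $\mathbb{F}_{q^m}$ by a matrix $G'\in\mathbb{F}_{q^m}^{k\times n}$ of rank $k$ (i.e. $r(V)=\mathrm{rk}(G'A_V^\top)$ for all $V\le\mathbb{F}_q^n$, where the rows of $A_V$ form a basis of $V$), then every independent space $V$ of $(\mathbb{F}_q^n,r)$ is $\mathbb{F}_{q^m}$-independent, in the sense that for any $\mathbb{F}_q$-basis $v_1,\dots,v_t$ of $V$ the vectors $G'v_1^\top,\dots,G'v_t^\top\in\mathbb{F}_{q^m}^k$ are linearly independent over $\mathbb{F}_{q^m}$.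
   Context: $q$ is a prime power, $m\ge1$. A $q$-matroid on an $\mathbb{F}_q$-vector space $W$ is a function $\rho$ from the subspaces of $W$ to $\mathbb{Z}$ with $0\le\rho(A)\le\dim A$, $\rho(A)\le\rho(B)$ for $A\le B$, and $\rho(A+B)+\rho(A\cap B)\le\rho(A)+\rho(B)$; a subspace $A$ is independent if $\rho(A)=\dim A$. An $\mathbb{F}_q$-subspace $V\le\mathcal{U}$ is called $\mathbb{F}_{q^m}$-independent if the vectors in one (equivalently, any) $\mathbb{F}_q$-basis of $V$ are linearly independent over $\mathbb{F}_{q^m}$. *)

theory Defs
  imports "HOL-Analysis.Analysis"
begin

text \<open>
  The fields \<open>F_q\<close> and \<open>F_{q^m}\<close> are the finite field types \<open>'f\<close> and \<open>'e\<close>, the inclusion of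
  the former in the latter being an embedding \<open>\<iota> :: 'f \<Rightarrow> 'e\<close>. Linear algebra over \<open>'e\<close> in
  \<open>'e ^ 'k\<close> is that of the library (\<open>vec\<close>, with scaling \<open>(*s)\<close>); linear algebra over \<open>'f\<close> in
  \<open>'e ^ 'k\<close> is that of the library's vector spaces with the restricted scaling below.
\<close>

definition field_embedding :: "('f::field \<Rightarrow> 'e::field) \<Rightarrow> bool" where
  "field_embedding \<iota> \<longleftrightarrow>
     \<iota> 1 = 1 \<and> (\<forall>x y. \<iota> (x + y) = \<iota> x + \<iota> y) \<and> (\<forall>x y. \<iota> (x * y) = \<iota> x * \<iota> y)"

definition restr_scale :: "('f::field \<Rightarrow> 'e::field) \<Rightarrow> 'f \<Rightarrow> 'e ^ 'k \<Rightarrow> 'e ^ 'k" where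
  "restr_scale \<iota> c v = \<iota> c *s v"

definition embed_vec :: "('f::field \<Rightarrow> 'e::field) \<Rightarrow> 'f ^ 'n \<Rightarrow> 'e ^ 'n" where
  "embed_vec \<iota> v = (\<chi> l. \<iota> (v $ l))"

lemma vector_space_restr_scale:
  assumes "field_embedding \<iota>"
  shows "vector_space (restr_scale \<iota> :: 'f::field \<Rightarrow> 'e::field ^ 'k \<Rightarrow> 'e ^ 'k)"
  using assms
  by unfold_locales
    (auto simp: field_embedding_def restr_scale_def vec_eq_iff algebra_simps)

text \<open>
  Linear independence and bases for families: unlike for sets, a family with a repeated vector is
  dependent.
\<close>

definition indep_family ::
    "('a::field \<Rightarrow> 'v::ab_group_add \<Rightarrow> 'v) \<Rightarrow> 'i set \<Rightarrow> ('i \<Rightarrow> 'v) \<Rightarrow> bool" where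
  "indep_family scl I v \<longleftrightarrow> inj_on v I \<and> \<not> module.dependent scl (v ` I)"

definition basis_family ::
    "('a::field \<Rightarrow> 'v::ab_group_add \<Rightarrow> 'v) \<Rightarrow> 'v set \<Rightarrow> 'i set \<Rightarrow> ('i \<Rightarrow> 'v) \<Rightarrow> bool" where
  "basis_family scl V I v \<longleftrightarrow> indep_family scl I v \<and> module.span scl (v ` I) = V"

text \<open>
  The rank function is only constrained on the subspaces of the ground space \<open>W\<close>. Finiteness of
  \<open>W\<close> amounts to finite dimension, the scalar field being finite; without it, \<open>dim\<close> would not be
  meaningful.
\<close>

locale q_matroid = vector_space scl
  for scl :: "'f::{field,finite} \<Rightarrow> 'v::ab_group_add \<Rightarrow> 'v" +
  fixes W :: "'v set" and \<rho> :: "'v set \<Rightarrow> int"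
  assumes subspace_W: "subspace W"
    and finite_W: "finite W"
    and rank_nonneg: "\<lbrakk>subspace A; A \<subseteq> W\<rbrakk> \<Longrightarrow> 0 \<le> \<rho> A"
    and rank_le_dim: "\<lbrakk>subspace A; A \<subseteq> W\<rbrakk> \<Longrightarrow> \<rho> A \<le> int (dim A)"
    and rank_mono: "\<lbrakk>subspace A; subspace B; A \<subseteq> B; B \<subseteq> W\<rbrakk> \<Longrightarrow> \<rho> A \<le> \<rho> B"
    and rank_submodular: "\<lbrakk>subspace A; subspace B; A \<subseteq> W; B \<subseteq> W\<rbrakk>
      \<Longrightarrow> \<rho> {a + b | a b. a \<in> A \<and> b \<in> B} + \<rho> (A \<inter> B) \<le> \<rho> A + \<rho> B"

definition q_independent_spaces ::
    "('f::field \<Rightarrow> 'v::ab_group_add \<Rightarrow> 'v) \<Rightarrow> 'v set \<Rightarrow> ('v set \<Rightarrow> int) \<Rightarrow> 'v set set" where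
  "q_independent_spaces scl W \<rho> =
     {A. module.subspace scl A \<and> A \<subseteq> W \<and> \<rho> A = int (vector_space.dim scl A)}"

text \<open>\<open>V\<close> is meant to be an \<open>F_q\<close>-subspace of \<open>F_{q^m}^k\<close>.\<close>

definition ext_independent ::
    "('f::field \<Rightarrow> 'e::field) \<Rightarrow> ('e ^ 'k) set \<Rightarrow> bool" where
  "ext_independent \<iota> V \<longleftrightarrow>
     (\<exists>B. \<not> module.dependent (restr_scale \<iota>) B \<and> module.span (restr_scale \<iota>) B = V
        \<and> vec.independent B)"

text \<open>
  The matrix \<open>A_V\<close> has \<open>dim V\<close> rows, a number which varies with \<open>V\<close> and hence cannot be an index
  type. The matrix \<open>G' A_V\<^sup>T\<close> is thus represented by its family of columns, indexed by
  \<open>{..<t}\<close>, the \<open>j\<close>-th column being \<open>G' v_j\<^sup>T\<close> where \<open>v_j\<close> is the \<open>j\<close>-th row of \<open>A_V\<close>; its rank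
  is the dimension of its column space. The lemma \<open>rank_of_columns\<close> below shows that, for matrices
  with an index type for the columns, this is the library's \<open>rank\<close>.
\<close>

definition rank_of_cols :: "nat \<Rightarrow> (nat \<Rightarrow> 'e::field ^ 'k) \<Rightarrow> nat" where
  "rank_of_cols t M = vec.dim (vec.span (M ` {..<t}))"

lemma rank_le_dim_columns:
  fixes A :: "'a::field ^ 'n ^ 'm"
  shows "rank A \<le> vec.dim (columns A)"
proof -
  obtain B where B: "B \<subseteq> columns A" "vec.independent B" "columns A \<subseteq> vec.span B"
      "card B = vec.dim (columns A)"
    using vec.basis_exists by blast
  have fin: "finite B" using B(2) vec.finiteI_independent by blast
  have "\<exists>u. column j A = (\<Sum>b\<in>B. u b *s b)" for j
  proof -
    have "column j A \<in> vec.span B" using B(3) by (auto simp: columns_def)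
    then show ?thesis unfolding vec.span_finite[OF fin] by auto
  qed
  then obtain c where c: "\<And>j. column j A = (\<Sum>b\<in>B. c j b *s b)" by metis
  let ?R = "(\<lambda>b. \<chi> j. c j b) ` B"
  have "row i A \<in> vec.span ?R" for i
  proof -
    have "row i A = (\<Sum>b\<in>B. b $ i *s (\<chi> j. c j b))"
    proof (simp add: vec_eq_iff, intro allI)
      fix j
      have "row i A $ j = column j A $ i" by (simp add: row_def column_def)
      then show "row i A $ j = (\<Sum>b\<in>B. b $ i * c j b)" by (simp add: c mult.commute)
    qed
    then show ?thesis
      by (auto intro!: vec.span_sum vec.span_scale intro: vec.span_base)
  qed
  then have "rows A \<subseteq> vec.span ?R" by (auto simp: rows_def)
  then have "vec.dim (rows A) \<le> card ?R"
    using fin by (intro vec.dim_le_card) auto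
  also have "\<dots> \<le> card B" using fin by (rule card_image_le)
  finally show ?thesis using B(4) by (simp add: row_rank_def_gen)
qed

lemma rank_eq_dim_columns:
  fixes A :: "'a::field ^ 'n ^ 'm"
  shows "rank A = vec.dim (columns A)"
  using rank_le_dim_columns[of A] rank_le_dim_columns[of "transpose A"]
  by (simp add: row_rank_def_gen)

lemma rank_of_columns:
  fixes A :: "'a::field ^ 'n ^ 'm" and h :: "nat \<Rightarrow> 'n"
  assumes "bij_betw h {..<t} UNIV"
  shows "rank_of_cols t (\<lambda>j. column (h j) A) = rank A"
proof -
  have "(\<lambda>j. column (h j) A) ` {..<t} = (\<lambda>i. column i A) ` (h ` {..<t})"
    by (simp add: image_image)
  also have "\<dots> = columns A"
    using assms by (auto simp: bij_betw_def columns_def)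
  finally show ?thesis by (simp add: rank_of_cols_def rank_eq_dim_columns)
qed

definition represented_by ::
    "('f::field \<Rightarrow> 'e::field) \<Rightarrow> 'e ^ 'n ^ 'k \<Rightarrow> (('f ^ 'n) set \<Rightarrow> int) \<Rightarrow> bool" where
  "represented_by \<iota> G r \<longleftrightarrow>
     (\<forall>V t v. vec.subspace V \<and> basis_family (*s) V {..<t} v \<longrightarrow>
        r V = int (rank_of_cols t (\<lambda>j. G *v embed_vec \<iota> (v j))))"

end

theory Submission
  imports Defs
begin

text \<open>
  The rank function is \<open>\<rho>(A) = dim\<^sub>E \<langle>A\<rangle>\<^sub>E\<close>, with \<open>E = F\<^bsub>q^m\<^esub>\<close>: it is submodular because
  taking \<open>E\<close>-spans commutes with sums, while the span of \<open>A \<inter> B\<close> lies in the intersection of the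
  spans. An \<open>F\<^sub>q\<close>-basis of \<open>A\<close> spans \<open>\<langle>A\<rangle>\<^sub>E\<close>, so \<open>\<rho>(A) = dim A\<close> exactly when this basis is linearly
  independent over \<open>E\<close>. In the same way, the columns of \<open>G' A\<^sub>V\<^sup>T\<close> are independent as soon as the rank
  of this matrix is the number \<open>dim V\<close> of its columns.
\<close>

lemma vec_dim_submodular:
  fixes A B :: "('a::field ^ 'n) set"
  shows "vec.dim {a + b | a b. a \<in> A \<and> b \<in> B} + vec.dim (A \<inter> B) \<le> vec.dim A + vec.dim B"
proof -
  \<comment> \<open>The dimension formula for sums concerns subspaces, while \<open>A\<close> and
    \<open>B\<close> are arbitrary, so their spans take their place.\<close>
  let ?S = "{x + y | x y. x \<in> vec.span A \<and> y \<in> vec.span B}"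
  have "{a + b | a b. a \<in> A \<and> b \<in> B} \<subseteq> ?S"
    by (auto intro: vec.span_base)
  then have "vec.dim {a + b | a b. a \<in> A \<and> b \<in> B} \<le> vec.dim ?S"
    by (rule vec.dim_subset)
  moreover have "vec.dim (A \<inter> B) \<le> vec.dim (vec.span A \<inter> vec.span B)"
    by (rule vec.dim_subset) (auto intro: vec.span_base)
  moreover have "vec.dim ?S + vec.dim (vec.span A \<inter> vec.span B) = vec.dim A + vec.dim B"
    using vec.dim_sums_Int[of "vec.span A" "vec.span B"] by simp
  ultimately show ?thesis by linarith
qed

text \<open>The dimension is at most the size of the image, which is at most \<open>card I\<close>;
  the assumption collapses this chain. Equality of the sizes makes \<open>w\<close> injective, and a
  spanning set no larger than the dimension is independent.\<close>

lemma indep_family_if_dim_ge: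
  fixes w :: "'i \<Rightarrow> 'a::field ^ 'n"
  assumes "finite I" "card I \<le> vec.dim (w ` I)"
  shows "indep_family (*s) I w"
proof -
  have le: "vec.dim (w ` I) \<le> card (w ` I)"
    using assms(1) by (intro vec.dim_le_card') auto
  have "card (w ` I) = card I"
    using le assms card_image_le[of I w] by linarith
  then have inj: "inj_on w I"
    using assms(1) by (simp add: inj_on_iff_eq_card)
  have "vec.independent (w ` I)"
    by (rule vec.card_le_dim_spanning[where V = "w ` I"])
      (use assms \<open>card (w ` I) = card I\<close> in \<open>auto intro: vec.span_base\<close>)
  with inj show ?thesis by (simp add: indep_family_def)
qed

context
  fixes \<iota> :: "'f::field \<Rightarrow> 'e::field"
  assumes emb: "field_embedding \<iota>"
begin

interpretation restr: vector_space "restr_scale \<iota> :: 'f \<Rightarrow> 'e ^ 'k \<Rightarrow> 'e ^ 'k"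
  by (rule vector_space_restr_scale[OF emb])

text \<open>Scaling by \<open>c\<close> in \<open>'f\<close> is scaling by \<open>\<iota> c\<close>,
  so a subspace over \<open>'e\<close> is also one over \<open>'f\<close>.\<close>

lemma restr_span_subset_vec_span: "module.span (restr_scale \<iota>) S \<subseteq> vec.span S"
proof (rule restr.span_minimal)
  show "S \<subseteq> vec.span S" by (auto intro: vec.span_base)
  show "restr.subspace (vec.span S)"
    by (auto simp: restr.subspace_def restr_scale_def
        intro: vec.span_zero vec.span_add vec.span_scale)
qed

lemma vec_dim_restr_span: "vec.dim (module.span (restr_scale \<iota>) S) = vec.dim S"
proof (rule antisym)
  show "vec.dim (restr.span S) \<le> vec.dim S"
    using vec.dim_subset[OF restr_span_subset_vec_span] by simp
  show "vec.dim S \<le> vec.dim (restr.span S)"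
    by (rule vec.dim_subset) (auto intro: restr.span_base)
qed

text \<open>A basis over \<open>'f\<close> still spans over \<open>'e\<close>, though it may become
  dependent there.\<close>

lemma vec_dim_le_restr_dim:
  assumes "finite A"
  shows "vec.dim A \<le> vector_space.dim (restr_scale \<iota>) A"
proof -
  obtain B where B: "B \<subseteq> A" "restr.independent B" "A \<subseteq> restr.span B" "card B = restr.dim A"
    using restr.basis_exists by blast
  have "finite B" using B(1) assms finite_subset by blast
  moreover have "A \<subseteq> vec.span B" using B(3) restr_span_subset_vec_span by blast
  ultimately show ?thesis using vec.dim_le_card[of A B] B(4) by simp
qed

lemma ext_independent_iff_dim:
  assumes "module.subspace (restr_scale \<iota>) V" "finite V"
  shows "ext_independent \<iota> V \<longleftrightarrow> vec.dim V = vector_space.dim (restr_scale \<iota>) V"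
proof
  assume "ext_independent \<iota> V"
  then obtain B where B: "restr.independent B" "restr.span B = V" "vec.independent B"
    unfolding ext_independent_def by blast
  \<comment> \<open>\<open>B\<close> is independent over both fields, so its size computes both
    dimensions of \<open>V\<close>.\<close>
  have "vec.dim V = card B"
    using vec_dim_restr_span[of B] vec.dim_eq_card_independent[OF B(3)] B(2) by simp
  also have "\<dots> = restr.dim V"
    using restr.dim_span_eq_card_independent[OF B(1)] B(2) by simp
  finally show "vec.dim V = restr.dim V" .
next
  assume eq: "vec.dim V = restr.dim V"
  obtain B where B: "B \<subseteq> V" "restr.independent B" "V \<subseteq> restr.span B" "card B = restr.dim V"
    using restr.basis_exists by blast
  have "restr.span B = V"
    using B(1,3) assms(1) restr.span_minimal by blast
  \<comment> \<open>Over \<open>'e\<close>, the span of \<open>B\<close> contains \<open>V\<close>,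
    and \<open>B\<close> has only as many elements as the dimension of \<open>V\<close>, so none is
    redundant.\<close>
  moreover have "vec.independent B"
    by (rule vec.card_le_dim_spanning[of B V])
      (use B eq assms(2) finite_subset restr_span_subset_vec_span[of B] in auto)
  ultimately show "ext_independent \<iota> V"
    using B(2) unfolding ext_independent_def by blast
qed

end

lemma q_matroid_vec_dim:
  fixes \<iota> :: "'f::{field,finite} \<Rightarrow> 'e::field" and U :: "('e ^ 'k) set"
  assumes emb: "field_embedding \<iota>"
    and U: "module.subspace (restr_scale \<iota>) U" "finite U"
  shows "q_matroid (restr_scale \<iota>) U (\<lambda>A. int (vec.dim A))"
proof -
  interpret restr: vector_space "restr_scale \<iota> :: 'f \<Rightarrow> 'e ^ 'k \<Rightarrow> 'e ^ 'k"
    by (rule vector_space_restr_scale[OF emb])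
  show ?thesis
  proof
    show "restr.subspace U" "finite U" by fact+
  next
    fix A assume "restr.subspace A" "A \<subseteq> U"
    then show "int (vec.dim A) \<le> int (restr.dim A)"
      using vec_dim_le_restr_dim[OF emb, of A] finite_subset[OF _ U(2)] by simp
  next
    fix A B :: "('e ^ 'k) set"
    assume "A \<subseteq> B"
    then show "int (vec.dim A) \<le> int (vec.dim B)"
      by (simp add: vec.dim_subset)
  next
    fix A B :: "('e ^ 'k) set"
    show "int (vec.dim {a + b | a b. a \<in> A \<and> b \<in> B}) + int (vec.dim (A \<inter> B))
        \<le> int (vec.dim A) + int (vec.dim B)"
      using vec_dim_submodular[of A B]
      by (simp flip: of_nat_add)
  qed simp
qed

text \<open>The rank of \<open>V\<close> is evaluated twice: independence gives \<open>t\<close>,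
  and the representation gives the dimension spanned by the \<open>t\<close> columns.\<close>

lemma indep_family_if_represented:
  fixes G :: "'e::field ^ 'n ^ 'k" and r :: "('f::field ^ 'n) set \<Rightarrow> int"
  assumes rep: "represented_by \<iota> G r"
    and V: "V \<in> q_independent_spaces (*s) W r"
    and basis: "basis_family (*s) V {..<t::nat} v"
  shows "indep_family (*s) {..<t} (\<lambda>j. G *v embed_vec \<iota> (v j))"
proof (rule indep_family_if_dim_ge)
  have "vec.dim V = card (v ` {..<t})"
    using basis vec.dim_span_eq_card_independent[of "v ` {..<t}"]
    by (simp add: basis_family_def indep_family_def)
  \<comment> \<open>A basis family is injective, so its image has exactly \<open>t\<close>
    elements.\<close>
  also have "\<dots> = t"
    using basis by (simp add: basis_family_def indep_family_def card_image)
  finally have "r V = int t"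
    using V by (simp add: q_independent_spaces_def)
  moreover have "r V = int (rank_of_cols t (\<lambda>j. G *v embed_vec \<iota> (v j)))"
    using rep V basis unfolding represented_by_def q_independent_spaces_def by blast
  ultimately show "card {..<t} \<le> vec.dim ((\<lambda>j. G *v embed_vec \<iota> (v j)) ` {..<t})"
    by (simp add: rank_of_cols_def)
qed simp

theorem theorem4p5:
  fixes \<iota> :: "'f::{field,finite} \<Rightarrow> 'e::{field,finite}"
    and q m :: nat
  assumes "CARD('f) = q" and "CARD('e) = q ^ m" and "m \<ge> 1"
    and "field_embedding \<iota>"
  shows
    "(\<forall>(G :: 'e ^ 'n ^ 'k) U.
        rank G = CARD('k) \<and>
        indep_family (restr_scale \<iota>) UNIV (\<lambda>j. column j G) \<and>
        U = module.span (restr_scale \<iota>) (columns G) \<longrightarrow>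
        (\<exists>\<rho>. q_matroid (restr_scale \<iota>) U \<rho> \<and>
             q_independent_spaces (restr_scale \<iota>) U \<rho> =
               {V. module.subspace (restr_scale \<iota>) V \<and> V \<subseteq> U \<and> ext_independent \<iota> V}))
     \<and>
     (\<forall>(G' :: 'e ^ 'n ^ 'k) (r :: ('f ^ 'n) set \<Rightarrow> int).
        rank G' = CARD('k) \<and>
        q_matroid (*s) UNIV r \<and>
        represented_by \<iota> G' r \<longrightarrow>
        (\<forall>V \<in> q_independent_spaces (*s) UNIV r.
           \<forall>(t :: nat) v. basis_family (*s) V {..<t} v \<longrightarrow>
             indep_family (*s) {..<t} (\<lambda>j. G' *v embed_vec \<iota> (v j))))"
proof (intro conjI allI impI ballI; (elim conjE)?)
  fix G :: "'e ^ 'n ^ 'k" and U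
  assume U: "U = module.span (restr_scale \<iota>) (columns G)"
  interpret restr: vector_space "restr_scale \<iota> :: 'f \<Rightarrow> 'e ^ 'k \<Rightarrow> 'e ^ 'k"
    by (rule vector_space_restr_scale) fact
  have "q_independent_spaces (restr_scale \<iota>) U (\<lambda>A. int (vec.dim A)) =
      {V. restr.subspace V \<and> V \<subseteq> U \<and> ext_independent \<iota> V}"
    \<comment> \<open>The criterion asks for finite \<open>V\<close>; this holds because
      \<open>'e\<close> is finite.\<close>
    using ext_independent_iff_dim[OF \<open>field_embedding \<iota>\<close>]
    by (auto simp: q_independent_spaces_def)
  moreover have "q_matroid (restr_scale \<iota>) U (\<lambda>A. int (vec.dim A))"
    by (rule q_matroid_vec_dim) (use assms in \<open>simp_all add: U\<close>)
  ultimately show "\<exists>\<rho>. q_matroid (restr_scale \<iota>) U \<rho> \<and>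
      q_independent_spaces (restr_scale \<iota>) U \<rho> =
        {V. restr.subspace V \<and> V \<subseteq> U \<and> ext_independent \<iota> V}"
    by blast
\<comment> \<open>What remains is the claim on represented q-matroids, with ground space
  \<open>UNIV\<close>.\<close>
qed (rule indep_family_if_represented)

end
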